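(* Let $(V,h)$ be a finite-dimensional metric vector space and let $k\ge2$. The linear map $\mathcal{MC}(V^* )\to\operatorname{End}(\otimes^kV^* )$ associating with $X\in\mathcal{MC}(V^* )$ the operator $\widehat X\in\operatorname{End}(\otimes^kV^* )$ defined by $$\widehat X(\alpha)_{i_1\dots i_k}=\tfrac1k\sum_{r\ne s}X^{p}{}_{i_ri_s}{}^{q}\,\alpha_{i_1\dots i_{r-1}p\,i_{r+1}\dots i_{s-1}q\,i_{s+1}\dots i_k}$$ has the following properties: each $\widehat X$ commutes with the action of the symmetric group $S_k$ on $\otimes^kV^*$, so preserves the type of tensors; the map is $O(h)$-equivariant, meaning $\widehat{g\cdot X}(\alpha)=g\cdot\widehat X(g^{-1}\cdot\alpha)$ for all $\alpha\in\otimes^kV^*$ and $g\in O(h)$; and it has image in the self-adjoint endomorphisms, meaning $\langle\widehat X(\alpha),\beta\rangle=\langle\alpha,\widehat X(\beta)\rangle$ for all $\alpha,\beta\in\otimes^kV^*$ and all $X\in\mathcal{MC}(V^* )$.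
   Context: All vector spaces are over $\mathbb{R}$. A metric vector space $(V,h)$ has a nondegenerate symmetric bilinear form $h_{ij}$ of any signature; indices are raised and lowered with $h$; brackets around indices denote complete antisymmetrization, normalized to be a projection. $\mathcal{MC}(V^* )=\{Y_{ijkl}\in\otimes^4V^*: Y_{[ij]kl}=Y_{ijkl}=Y_{ij[kl]},\ Y_{[ijk]l}=0\}$. The sum defining $\widehat X$ runs over ordered pairs $(r,s)$ of distinct elements of $\{1,\dots,k\}$, with $p$ in position $r$ and $q$ in position $s$ of $\alpha$ (whether $r<s$ or $r>s$). The pairing on $\otimes^kV^*$ is complete contraction, $\langle\alpha,\beta\rangle=\alpha_{i_1\dots i_k}\beta^{i_1\dots i_k}$. $O(h)$ is the group of linear automorphisms of $V$ preserving $h$, acting on tensors in the usual way. $S_k$ acts on $\otimes^kV^*$ by $(\sigma\cdot\alpha)_{i_1\dots i_k}=\alpha_{i_{\sigma^{-1}(1)}\dots i_{\sigma^{-1}(k)}}$. A filling of a $k$-box Young diagram by the indices determines the subspace of $\otimes^kV^*$ of tensors antisymmetric in the indices in each column and whose antisymmetrization over all indices of a column plus any one index from a column to its right vanishes; preserving type means mapping each such subspace into itself. *)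

theory Defs
  imports "HOL-Analysis.Analysis" "HOL-Combinatorics.Permutations"
begin

text \<open>
  Elements of \<open>\<otimes>\<^sup>k V\<^sup>*\<close> are represented as multilinear forms. The form \<open>\<alpha>\<close> takes its
  \<open>k\<close> arguments as a family \<open>v :: nat \<Rightarrow> 'v\<close> of which only \<open>v 1, \<dots>, v k\<close> matter, so
  \<open>\<alpha> v\<close> is the contraction of \<open>v r\<close> with the \<open>r\<close>-th index of \<open>\<alpha>\<close> for \<open>r = 1, \<dots>, k\<close>.
  Independence of the other arguments makes equality of tensors coincide with equality of
  functions.
\<close>

type_synonym 'v form = "(nat \<Rightarrow> 'v) \<Rightarrow> real"

definition tensors :: "nat \<Rightarrow> 'v::real_vector form set" where
  "tensors k = {\<alpha>. (\<forall>v w. (\<forall>i\<in>{1..k}. v i = w i) \<longrightarrow> \<alpha> v = \<alpha> w) \<and>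
                   (\<forall>v. \<forall>i\<in>{1..k}. linear (\<lambda>x. \<alpha> (v(i := x))))}"

definition finite_dim :: "'v::real_vector itself \<Rightarrow> bool" where
  "finite_dim _ \<longleftrightarrow> (\<exists>B :: 'v set. finite B \<and> span B = UNIV)"

definition metric_form :: "('v::real_vector \<Rightarrow> 'v \<Rightarrow> real) \<Rightarrow> bool" where
  "metric_form h \<longleftrightarrow> bilinear h \<and> (\<forall>x y. h x y = h y x) \<and> (\<forall>x. (\<forall>y. h x y = 0) \<longrightarrow> x = 0)"


subsection \<open>Actions on tensors and symmetrizers\<close>

text \<open>
  In \<open>\<sigma> \<cdot> \<alpha>\<close>, slot \<open>j\<close> of \<open>\<alpha>\<close> carries the index numbered \<open>inv \<sigma> j\<close>, hence is evaluated on
  the argument with that number.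
\<close>

definition perm_act :: "(nat \<Rightarrow> nat) \<Rightarrow> 'v form \<Rightarrow> 'v form" where
  "perm_act \<sigma> \<alpha> = (\<lambda>v. \<alpha> (\<lambda>j. v (inv \<sigma> j)))"

definition orthogonal_group :: "('v::real_vector \<Rightarrow> 'v \<Rightarrow> real) \<Rightarrow> ('v \<Rightarrow> 'v) set" where
  "orthogonal_group h = {g. linear g \<and> bij g \<and> (\<forall>x y. h (g x) (g y) = h x y)}"

definition lin_act :: "('v \<Rightarrow> 'v) \<Rightarrow> 'v form \<Rightarrow> 'v form" where
  "lin_act g \<alpha> = (\<lambda>v. \<alpha> (\<lambda>j. inv g (v j)))"

definition alternate :: "nat set \<Rightarrow> 'v form \<Rightarrow> 'v form" where
  "alternate S \<alpha> = (\<lambda>v. (\<Sum>\<sigma> | \<sigma> permutes S. of_int (sign \<sigma>) * perm_act \<sigma> \<alpha> v) / fact (card S))"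

definition MC :: "'v::real_vector form set" where
  "MC = {Y \<in> tensors 4. alternate {1, 2} Y = Y \<and> alternate {3, 4} Y = Y \<and>
                        alternate {1, 2, 3} Y = (\<lambda>v. 0)}"

text \<open>
  A filling of a \<open>k\<close>-box Young diagram by \<open>1, \<dots>, k\<close> is given as the list of its columns from
  left to right, each column being listed from top to bottom.
\<close>

definition young_filling :: "nat \<Rightarrow> nat list list \<Rightarrow> bool" where
  "young_filling k cs \<longleftrightarrow> [] \<notin> set cs \<and> sorted_wrt (\<ge>) (map length cs) \<and>
     distinct (concat cs) \<and> set (concat cs) = {1..k}"

definition young_subspace :: "nat \<Rightarrow> nat list list \<Rightarrow> 'v::real_vector form set" where
  "young_subspace k cs = {\<alpha> \<in> tensors k.
     (\<forall>c\<in>set cs. alternate (set c) \<alpha> = \<alpha>) \<and>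
     (\<forall>a b. a < b \<and> b < length cs \<longrightarrow>
        (\<forall>j\<in>set (cs ! b). alternate (insert j (set (cs ! a))) \<alpha> = (\<lambda>v. 0)))}"


subsection \<open>Contractions\<close>

text \<open>
  With respect to a basis \<open>B\<close>, raising an index with \<open>h\<close> amounts to evaluation on the
  \<open>h\<close>-dual basis vectors, so the trace of a bilinear form \<open>F\<close>, its first index being raised, is
  \<open>\<Sum>b\<in>B. F (dual_vec h B b) b\<close>. The basis is an arbitrary one; the lemmas
  \<open>contract_basis\<close> and \<open>pairing_basis\<close> show that its choice is irrelevant.
\<close>

definition some_basis :: "'v::real_vector set" where
  "some_basis = (SOME B. independent B \<and> span B = UNIV)"

definition dual_vec :: "('v::real_vector \<Rightarrow> 'v \<Rightarrow> real) \<Rightarrow> 'v set \<Rightarrow> 'v \<Rightarrow> 'v" where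
  "dual_vec h B b = (THE x. \<forall>c\<in>B. h x c = (if c = b then 1 else 0))"

definition contract :: "('v::real_vector \<Rightarrow> 'v \<Rightarrow> real) \<Rightarrow> ('v \<Rightarrow> 'v \<Rightarrow> real) \<Rightarrow> real" where
  "contract h F = (\<Sum>b\<in>some_basis. F (dual_vec h some_basis b) b)"

definition pairing ::
  "('v::real_vector \<Rightarrow> 'v \<Rightarrow> real) \<Rightarrow> nat \<Rightarrow> 'v form \<Rightarrow> 'v form \<Rightarrow> real" where
  "pairing h k \<alpha> \<beta> =
     (\<Sum>I \<in> {1..k} \<rightarrow>\<^sub>E some_basis. \<alpha> I * \<beta> (\<lambda>i. dual_vec h some_basis (I i)))"

definition args4 :: "'v \<Rightarrow> 'v \<Rightarrow> 'v \<Rightarrow> 'v \<Rightarrow> nat \<Rightarrow> 'v" where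
  "args4 a b c d = (\<lambda>n. if n = 1 then a else if n = 2 then b else if n = 3 then c else d)"

text \<open>
  In \<open>X\<close> the first and last indices are raised: \<open>p'\<close>, \<open>q'\<close> below are the
  arguments of \<open>X\<close> contracted with the arguments \<open>p\<close>, \<open>q\<close> of \<open>\<alpha>\<close>.
\<close>

definition hat ::
  "('v::real_vector \<Rightarrow> 'v \<Rightarrow> real) \<Rightarrow> nat \<Rightarrow> 'v form \<Rightarrow> 'v form \<Rightarrow> 'v form" where
  "hat h k X \<alpha> = (\<lambda>v. 1 / real k *
     (\<Sum>(r, s) \<in> {(r, s). r \<in> {1..k} \<and> s \<in> {1..k} \<and> r \<noteq> s}.
        contract h (\<lambda>p' p. contract h (\<lambda>q' q.
          X (args4 p' (v r) (v s) q') * \<alpha> (v(r := p, s := q))))))"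


subsection \<open>Independence of the basis\<close>

lemma finite_basis:
  assumes "finite_dim TYPE('v::real_vector)" "independent (B :: 'v set)"
  shows "finite B"
proof -
  obtain T :: "'v set" where "finite T" "span T = UNIV"
    using assms(1) by (auto simp: finite_dim_def)
  then show ?thesis using independent_span_bound[of T B] assms(2) by simp
qed

lemma some_basis:
  "independent (some_basis :: 'v::real_vector set)" "span (some_basis :: 'v set) = UNIV"
proof -
  obtain C :: "'v set" where "independent C" "UNIV \<subseteq> span C"
    by (rule maximal_independent_subset[of "UNIV :: 'v set"])
  then have "\<exists>B :: 'v set. independent B \<and> span B = UNIV"
    by (intro exI[of _ C]) auto
  from someI_ex[OF this] show "independent (some_basis :: 'v set)" "span (some_basis :: 'v set) = UNIV"
    unfolding some_basis_def by auto
qed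

lemma dual_vec:
  fixes h :: "'v::real_vector \<Rightarrow> 'v \<Rightarrow> real"
  assumes m: "metric_form h" and B: "independent B" "span B = UNIV" "finite B"
    and b: "b \<in> B" and c: "c \<in> B"
  shows "h (dual_vec h B b) c = (if c = b then 1 else 0)"
proof -
  interpret fd: finite_dimensional_vector_space "scaleR :: real \<Rightarrow> 'v \<Rightarrow> 'v" B
    by unfold_locales (use B in \<open>auto simp: dependent_raw_def[symmetric] span_raw_def[symmetric]\<close>)
  from m have bil: "bilinear h" and nd: "\<And>x. (\<forall>y. h x y = 0) \<Longrightarrow> x = 0"
    by (auto simp: metric_form_def)
  have zero: "x = 0" if "\<And>c. c \<in> B \<Longrightarrow> h x c = 0" for x
  proof (rule nd, rule allI)
    fix y
    have "y \<in> Real_Vector_Spaces.span B" using B by simp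
    moreover have "linear (h x)" using bil by (simp add: bilinear_def)
    ultimately show "h x y = 0"
      using real_vector.linear_eq_0_on_span[of "h x" B y] that by blast
  qed
  define T where "T x = (\<Sum>c\<in>B. h x c *\<^sub>R c)" for x
  have "linear T"
    by (rule linearI) (simp_all add: T_def bilinear_ladd[OF bil] bilinear_lmul[OF bil]
        scaleR_left_distrib sum.distrib scaleR_sum_right)
  moreover have coeff: "h x c = f c" if "(\<Sum>c\<in>B. h x c *\<^sub>R c) = (\<Sum>c\<in>B. f c *\<^sub>R c)" "c \<in> B" for x f c
  proof -
    have "(\<Sum>c\<in>B. (h x c - f c) *\<^sub>R c) = 0"
      using that by (simp add: scaleR_left_diff_distrib sum_subtractf)
    with B(1,3) that(2) have "h x c - f c = 0"
      using independentD[of B B "\<lambda>c. h x c - f c" c] by simp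
    then show ?thesis by simp
  qed
  moreover have "inj T"
  proof (rule injI)
    fix x y assume "T x = T y"
    then have "h x c = h y c" if "c \<in> B" for c
      using coeff[of x "h y"] that by (simp add: T_def)
    then have "x - y = 0"
      by (intro zero) (simp add: bilinear_lsub[OF bil])
    then show "x = y" by simp
  qed
  ultimately have "surj T"
    using fd.linear_inj_imp_surj by (simp add: linear_def)
  then obtain x where "T x = b" by (metis surjD)
  then have "(\<Sum>c\<in>B. h x c *\<^sub>R c) = (\<Sum>c\<in>B. (if c = b then 1 else 0) *\<^sub>R c)"
    using b B(3) by (simp add: T_def if_distrib[of "\<lambda>t. t *\<^sub>R _"] cong: if_cong)
  then have x: "\<forall>c\<in>B. h x c = (if c = b then 1 else 0)"
    using coeff[of x "\<lambda>c. if c = b then 1 else 0"] by blast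
  have "dual_vec h B b = x"
    unfolding dual_vec_def
  proof (rule the_equality)
    show "\<forall>c\<in>B. h x c = (if c = b then 1 else 0)" by (fact x)
    fix y assume "\<forall>c\<in>B. h y c = (if c = b then 1 else 0)"
    then have "y - x = 0" using x by (intro zero) (simp add: bilinear_lsub[OF bil])
    then show "y = x" by simp
  qed
  with x c show ?thesis by simp
qed

lemma basis_expand:
  fixes h :: "'v::real_vector \<Rightarrow> 'v \<Rightarrow> real"
  assumes m: "metric_form h" and B: "independent B" "span B = UNIV" "finite B"
  shows "(\<Sum>b\<in>B. h (dual_vec h B b) x *\<^sub>R b) = x" (is ?A)
    and "(\<Sum>b\<in>B. h x b *\<^sub>R dual_vec h B b) = x" (is ?B)
proof -
  have bil: "bilinear h" and nd: "\<And>x. (\<forall>y. h x y = 0) \<Longrightarrow> x = 0"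
    using m by (auto simp: metric_form_def)
  have lin: "linear (h x)" for x using bil by (simp add: bilinear_def)
  have A: "(\<Sum>b\<in>B. h (dual_vec h B b) x *\<^sub>R b) = x" for x
  proof -
    have "x \<in> span B" using B by simp
    then obtain f where f: "x = (\<Sum>b\<in>B. f b *\<^sub>R b)"
      using span_finite[OF B(3)] by auto
    have "h (dual_vec h B b) x = f b" if "b \<in> B" for b
    proof -
      have "h (dual_vec h B b) x = (\<Sum>c\<in>B. f c * h (dual_vec h B b) c)"
        unfolding f by (simp add: linear_sum[OF lin] linear_scale[OF lin])
      also have "\<dots> = (\<Sum>c\<in>B. if c = b then f c else 0)"
        by (rule sum.cong) (auto simp: dual_vec[OF m B that])
      finally show ?thesis using that B(3) by simp
    qed
    then show ?thesis by (subst (2) f) simp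
  qed
  show ?A by (rule A)
  have lin': "linear (\<lambda>x. h x y)" for y using bil by (simp add: bilinear_def)
  have "(\<Sum>b\<in>B. h x b *\<^sub>R dual_vec h B b) - x = 0"
  proof (rule nd, rule allI)
    fix y
    have "h (\<Sum>b\<in>B. h x b *\<^sub>R dual_vec h B b) y = (\<Sum>b\<in>B. h x b * h (dual_vec h B b) y)"
      by (simp add: linear_sum[OF lin'] linear_scale[OF lin'])
    also have "\<dots> = h x (\<Sum>b\<in>B. h (dual_vec h B b) y *\<^sub>R b)"
      by (simp add: linear_sum[OF lin] linear_scale[OF lin] mult.commute)
    finally show "h ((\<Sum>b\<in>B. h x b *\<^sub>R dual_vec h B b) - x) y = 0"
      by (simp add: A bilinear_lsub[OF bil])
  qed
  then show ?B by simp
qed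

lemma trace_basis_indep:
  fixes h :: "'v::real_vector \<Rightarrow> 'v \<Rightarrow> real"
  assumes m: "metric_form h" and B: "independent B" "span B = UNIV" "finite B"
    and C: "independent C" "span C = UNIV" "finite C" and F: "bilinear F"
  shows "(\<Sum>b\<in>B. F (dual_vec h B b) b) = (\<Sum>c\<in>C. F (dual_vec h C c) c :: real)"
proof -
  have l1: "linear (\<lambda>x. F x y)" and l2: "linear (F x)" for x y
    using F by (simp_all add: bilinear_def)
  have "(\<Sum>b\<in>B. F (dual_vec h B b) b)
      = (\<Sum>b\<in>B. F (\<Sum>c\<in>C. h (dual_vec h B b) c *\<^sub>R dual_vec h C c) b)"
    by (simp add: basis_expand(2)[OF m C])
  also have "\<dots> = (\<Sum>b\<in>B. \<Sum>c\<in>C. h (dual_vec h B b) c * F (dual_vec h C c) b)"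
    by (simp add: linear_sum[OF l1] linear_scale[OF l1])
  also have "\<dots> = (\<Sum>c\<in>C. \<Sum>b\<in>B. h (dual_vec h B b) c * F (dual_vec h C c) b)"
    by (rule sum.swap)
  also have "\<dots> = (\<Sum>c\<in>C. F (dual_vec h C c) (\<Sum>b\<in>B. h (dual_vec h B b) c *\<^sub>R b))"
    by (simp add: linear_sum[OF l2] linear_scale[OF l2])
  finally show ?thesis by (simp add: basis_expand(1)[OF m B])
qed

lemma contract_basis:
  fixes h :: "'v::real_vector \<Rightarrow> 'v \<Rightarrow> real"
  assumes "finite_dim TYPE('v)" "metric_form h" "independent B" "span B = UNIV" "bilinear F"
  shows "contract h F = (\<Sum>b\<in>B. F (dual_vec h B b) b)"
  unfolding contract_def
  using assms trace_basis_indep[of h some_basis B F] some_basis finite_basis by blast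

lemma tensors_cong:
  assumes "\<alpha> \<in> tensors k" "\<And>i. i \<in> {1..k} \<Longrightarrow> v i = w i"
  shows "\<alpha> v = \<alpha> w"
  using assms unfolding tensors_def by blast

lemma sum_PiE_insert:
  assumes "finite S" "j \<notin> S"
  shows "(\<Sum>I\<in>insert j S \<rightarrow>\<^sub>E B. G I) = (\<Sum>b\<in>B. \<Sum>I\<in>S \<rightarrow>\<^sub>E B. G (I(j := b)))"
  unfolding PiE_insert_eq
  by (subst sum.reindex) (use inj_combinator[OF assms(2), of "\<lambda>_. B"] in
      \<open>auto simp: sum.cartesian_product case_prod_unfold\<close>)

lemma pairing_basis_indep:
  fixes h :: "'v::real_vector \<Rightarrow> 'v \<Rightarrow> real"
  assumes m: "metric_form h" and B: "independent B" "span B = UNIV" "finite B"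
    and C: "independent C" "span C = UNIV" "finite C"
    and ab: "\<alpha> \<in> tensors k" "\<beta> \<in> tensors k" and S: "S \<subseteq> {1..k}"
  shows "(\<Sum>I\<in>S \<rightarrow>\<^sub>E B. \<alpha> (\<lambda>i. if i \<in> S then I i else v i) *
            \<beta> (\<lambda>i. if i \<in> S then dual_vec h B (I i) else w i)) =
         (\<Sum>I\<in>S \<rightarrow>\<^sub>E C. \<alpha> (\<lambda>i. if i \<in> S then I i else v i) *
            \<beta> (\<lambda>i. if i \<in> S then dual_vec h C (I i) else w i))"
proof -
  have "finite S" using S finite_subset by blast
  then show ?thesis using S
  proof (induction S arbitrary: v w rule: finite_induct)
    case empty
    then show ?case by simp
  next
    case (insert j S)
    let ?G = "\<lambda>D v w. \<Sum>I\<in>S \<rightarrow>\<^sub>E D. \<alpha> (\<lambda>i. if i \<in> S then I i else v i) *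
                \<beta> (\<lambda>i. if i \<in> S then dual_vec h D (I i) else w i)"
    have step: "(\<Sum>I\<in>insert j S \<rightarrow>\<^sub>E D. \<alpha> (\<lambda>i. if i \<in> insert j S then I i else v i) *
            \<beta> (\<lambda>i. if i \<in> insert j S then dual_vec h D (I i) else w i))
          = (\<Sum>b\<in>D. ?G D (v(j := b)) (w(j := dual_vec h D b)))" for D
      unfolding sum_PiE_insert[OF insert.hyps]
      using insert.hyps(2)
      by (intro sum.cong refl arg_cong2[of _ _ _ _ "(*)"] arg_cong[of _ _ \<alpha>] arg_cong[of _ _ \<beta>] ext) auto
    have upd: "(\<lambda>i. if i \<in> S then f i else (u(j := x)) i) = (\<lambda>i. if i \<in> S then f i else u i)(j := x)"
      for f u and x :: 'v using insert.hyps(2) by auto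
    have j: "j \<in> {1..k}" using insert.prems by auto
    have "linear (\<lambda>x. \<alpha> (u(j := x)))" "linear (\<lambda>x. \<beta> (u(j := x)))" for u
      using ab j unfolding tensors_def by blast+
    then have lin: "\<alpha> (u(j := x + y)) = \<alpha> (u(j := x)) + \<alpha> (u(j := y))"
      "\<beta> (u(j := x + y)) = \<beta> (u(j := x)) + \<beta> (u(j := y))"
      "\<alpha> (u(j := c *\<^sub>R x)) = c * \<alpha> (u(j := x))"
      "\<beta> (u(j := c *\<^sub>R x)) = c * \<beta> (u(j := x))" for u x y c
      by (simp_all add: linear_iff)
    have "bilinear (\<lambda>y x. ?G C (v(j := x)) (w(j := y)))"
      unfolding bilinear_def linear_iff upd lin
      by (simp add: sum.distrib sum_distrib_left algebra_simps del: fun_upd_apply)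
    from trace_basis_indep[OF m B C this]
    show ?case
      unfolding step using insert.IH insert.prems by simp
  qed
qed

lemma pairing_basis:
  fixes h :: "'v::real_vector \<Rightarrow> 'v \<Rightarrow> real"
  assumes fd: "finite_dim TYPE('v)" and m: "metric_form h" and B: "independent B" "span B = UNIV"
    and ab: "\<alpha> \<in> tensors k" "\<beta> \<in> tensors k"
  shows "pairing h k \<alpha> \<beta> = (\<Sum>I \<in> {1..k} \<rightarrow>\<^sub>E B. \<alpha> I * \<beta> (\<lambda>i. dual_vec h B (I i)))"
proof -
  have eq: "\<alpha> (\<lambda>i. if i \<in> {1..k} then I i else 0) = \<alpha> I"
    "\<beta> (\<lambda>i. if i \<in> {1..k} then dual_vec h D (I i) else 0) = \<beta> (\<lambda>i. dual_vec h D (I i))" for I D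
    by (rule tensors_cong[OF ab(1)], simp) (rule tensors_cong[OF ab(2)], simp)
  show ?thesis
    using pairing_basis_indep[OF m some_basis finite_basis[OF fd some_basis(1)] B
        finite_basis[OF fd B(1)] ab order_refl, of "\<lambda>_. 0" "\<lambda>_. 0"]
    unfolding pairing_def eq .
qed


subsection \<open>\<open>MC\<close> is an \<open>O(h)\<close>-invariant subspace\<close>

lemma MC_lincomb:
  assumes "X \<in> MC" "Y \<in> MC"
  shows "(\<lambda>v. a * X v + b * Y v) \<in> MC"
proof -
  have alt: "alternate S (\<lambda>v. a * X v + b * Y v) = (\<lambda>v. a * alternate S X v + b * alternate S Y v)" for S
    by (simp add: alternate_def perm_act_def sum.distrib sum_distrib_left algebra_simps
        add_divide_distrib sum_divide_distrib)
  have "(\<lambda>v. a * X v + b * Y v) \<in> tensors 4"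
    unfolding tensors_def mem_Collect_eq
  proof (intro conjI allI impI ballI)
    fix v w :: "nat \<Rightarrow> 'a" assume "\<forall>i\<in>{1..4}. v i = w i"
    then have "X v = X w" "Y v = Y w"
      using assms tensors_cong[of _ 4 v w] by (auto simp: MC_def)
    then show "a * X v + b * Y v = a * X w + b * Y w" by simp
  next
    fix v :: "nat \<Rightarrow> 'a" and i :: nat assume "i \<in> {1..4}"
    then have "linear (\<lambda>x. X (v(i := x)))" "linear (\<lambda>x. Y (v(i := x)))"
      using assms unfolding MC_def tensors_def by blast+
    then show "linear (\<lambda>x. a * X (v(i := x)) + b * Y (v(i := x)))"
      by (simp add: linear_iff algebra_simps)
  qed
  with assms show ?thesis by (simp add: MC_def alt)
qed

lemma MC_lin_act:
  assumes X: "X \<in> MC" and g: "g \<in> orthogonal_group h"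
  shows "lin_act g X \<in> MC"
proof -
  have alt: "alternate S (lin_act g X) = lin_act g (alternate S X)" for S
    by (simp add: alternate_def perm_act_def lin_act_def)
  have g': "linear g" "bij g" using g by (simp_all add: orthogonal_group_def)
  have inv: "linear (inv g)"
  proof (rule linearI)
    fix x y and c :: real
    have gi: "g (inv g z) = z" "inv g (g z) = z" for z
      using g'(2) by (simp_all add: bij_is_inj bij_is_surj surj_f_inv_f)
    show "inv g (x + y) = inv g x + inv g y"
      using gi linear_add[OF g'(1), of "inv g x" "inv g y"] by metis
    show "inv g (c *\<^sub>R x) = c *\<^sub>R inv g x"
      using gi linear_scale[OF g'(1), of c "inv g x"] by metis
  qed
  have "lin_act g X \<in> tensors 4"
    unfolding tensors_def mem_Collect_eq lin_act_def
  proof (intro conjI allI impI ballI)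
    fix v w :: "nat \<Rightarrow> 'a" assume "\<forall>i\<in>{1..4}. v i = w i"
    then show "X (\<lambda>j. inv g (v j)) = X (\<lambda>j. inv g (w j))"
      using X by (intro tensors_cong[of X 4]) (auto simp: MC_def)
  next
    fix v :: "nat \<Rightarrow> 'a" and i :: nat assume "i \<in> {1..4}"
    then have "linear (\<lambda>y. X ((\<lambda>j. inv g (v j))(i := y)))"
      using X unfolding MC_def tensors_def by blast
    from linear_compose[OF inv this]
    have "linear (\<lambda>x. X ((\<lambda>j. inv g (v j))(i := inv g x)))" by (simp add: o_def)
    moreover have "(\<lambda>j. inv g (v j))(i := inv g x) = (\<lambda>j. inv g ((v(i := x)) j))" for x
      by auto
    ultimately show "linear (\<lambda>x. X (\<lambda>j. inv g ((v(i := x)) j)))" by (simp only:)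
  qed
  moreover have "lin_act g (\<lambda>v. 0) = (\<lambda>v. 0)" by (simp add: lin_act_def)
  ultimately show ?thesis using X by (simp add: MC_def alt)
qed

end

theory Submission
  imports Defs
begin

text \<open>
  Relabelling the slots permutes the summands of \<open>hat\<close>, which gives the \<open>S\<^sub>k\<close>-equivariance; hence
  \<open>hat h k X\<close> commutes with every alternation, and the Young subspaces are preserved.
  The \<open>O(h)\<close>-equivariance holds because a map moves from one argument of a contraction to the other
  as its adjoint, and the adjoint of \<open>inv g\<close> is \<open>g\<close>. Self-adjointness uses only
  \<open>X\<^sub>i\<^sub>p\<^sub>q\<^sub>j = X\<^sub>p\<^sub>i\<^sub>j\<^sub>q\<close>, that is, one transposition in each antisymmetric pair of indices.
\<close>

subsection \<open>Traces of bilinear forms\<close>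

lemma bilinear_times:
  fixes f g :: "'v::real_vector \<Rightarrow> real"
  assumes "linear f" "linear g"
  shows "bilinear (\<lambda>x y. f x * g y)"
  using assms by (simp add: bilinear_def linear_iff algebra_simps)

text \<open>A contraction is a finite or vanishing sum of values of its form, so bilinearity in
  further parameters survives it. This makes the outer form of an iterated contraction
  bilinear.\<close>

lemma bilinear_contract:
  assumes "\<And>p q. bilinear (\<lambda>x y. G x y p q)"
  shows "bilinear (\<lambda>x y. contract h (G x y))"
  unfolding contract_def bilinear_def linear_iff
  by (simp add: bilinear_ladd[OF assms] bilinear_radd[OF assms] bilinear_lmul[OF assms]
      bilinear_rmul[OF assms] sum.distrib sum_distrib_left)

text \<open>Expand the image of each dual vector under \<open>f\<close> in the dual basis. By
  adjointness its coefficients are also those of \<open>f' c\<close> in the basis, so after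
  exchanging the sums they reassemble in the second argument.\<close>

lemma contract_adjoint:
  fixes h :: "'v::real_vector \<Rightarrow> 'v \<Rightarrow> real"
  assumes fd: "finite_dim TYPE('v)" and h: "metric_form h" and F: "bilinear F"
    and adj: "\<And>x y. h (f x) y = h x (f' y)"
  shows "contract h (\<lambda>x y. F (f x) y) = contract h (\<lambda>x y. F x (f' y))"
proof -
  let ?B = "some_basis :: 'v set" and ?e = "dual_vec h (some_basis :: 'v set)"
  note B = h some_basis finite_basis[OF fd some_basis(1)]
  have l1: "linear (\<lambda>x. F x y)" and l2: "linear (F x)" for x y
    using F by (simp_all add: bilinear_def)
  have "contract h (\<lambda>x y. F (f x) y) = (\<Sum>b\<in>?B. F (\<Sum>c\<in>?B. h (f (?e b)) c *\<^sub>R ?e c) b)"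
    by (simp add: contract_def basis_expand(2)[OF B])
  also have "\<dots> = (\<Sum>b\<in>?B. \<Sum>c\<in>?B. h (?e b) (f' c) * F (?e c) b)"
    by (simp add: linear_sum[OF l1] linear_scale[OF l1] adj)
  also have "\<dots> = (\<Sum>c\<in>?B. F (?e c) (\<Sum>b\<in>?B. h (?e b) (f' c) *\<^sub>R b))"
    by (subst sum.swap) (simp add: linear_sum[OF l2] linear_scale[OF l2])
  finally show ?thesis by (simp add: contract_def basis_expand(1)[OF B])
qed

text \<open>Raising the first or the second index gives the same trace: the coefficients
  \<open>h b c\<close> of a basis vector in the dual basis are symmetric, so they can be moved from
  one argument to the other.\<close>

lemma contract_flip:
  fixes h :: "'v::real_vector \<Rightarrow> 'v \<Rightarrow> real"
  assumes fd: "finite_dim TYPE('v)" and h: "metric_form h" and F: "bilinear F"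
  shows "contract h (\<lambda>x y. F y x) = contract h F"
proof -
  let ?B = "some_basis :: 'v set" and ?e = "dual_vec h (some_basis :: 'v set)"
  note B = h some_basis finite_basis[OF fd some_basis(1)]
  have l1: "linear (\<lambda>x. F x y)" and l2: "linear (F x)" for x y
    using F by (simp_all add: bilinear_def)
  have sym: "h x y = h y x" for x y using h by (simp add: metric_form_def)
  have "contract h (\<lambda>x y. F y x) = (\<Sum>b\<in>?B. F (\<Sum>c\<in>?B. h b c *\<^sub>R ?e c) (?e b))"
    by (simp add: contract_def basis_expand(2)[OF B])
  also have "\<dots> = (\<Sum>b\<in>?B. \<Sum>c\<in>?B. h c b * F (?e c) (?e b))"
    by (simp add: linear_sum[OF l1] linear_scale[OF l1] sym)
  also have "\<dots> = (\<Sum>c\<in>?B. F (?e c) (\<Sum>b\<in>?B. h c b *\<^sub>R ?e b))"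
    by (subst sum.swap) (simp add: linear_sum[OF l2] linear_scale[OF l2])
  finally show ?thesis by (simp add: contract_def basis_expand(2)[OF B])
qed

lemma contract2_adjoint:
  fixes h :: "'v::real_vector \<Rightarrow> 'v \<Rightarrow> real"
  assumes fd: "finite_dim TYPE('v)" and h: "metric_form h"
    and bil1: "\<And>p' p. bilinear (\<lambda>q' q. M p' p q' q)" and bil2: "\<And>q' q. bilinear (\<lambda>p' p. M p' p q' q)"
    and adj: "\<And>x y. h (f x) y = h x (f' y)"
  shows "contract h (\<lambda>p' p. contract h (\<lambda>q' q. M (f p') p (f q') q)) =
    contract h (\<lambda>p' p. contract h (\<lambda>q' q. M p' (f' p) q' (f' q)))"
proof -
  \<comment> \<open>This is the outer form once the inner contraction has been moved to
    \<open>f'\<close>; the second application of adjointness acts on it.\<close>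
  have "bilinear (\<lambda>p' p. contract h (\<lambda>q' q. M p' p q' (f' q)))"
    by (rule bilinear_contract) (rule bil2)
  from contract_adjoint[OF fd h this adj] show ?thesis
    by (simp only: contract_adjoint[OF fd h bil1 adj])
qed

lemma contract2_flip:
  fixes h :: "'v::real_vector \<Rightarrow> 'v \<Rightarrow> real"
  assumes fd: "finite_dim TYPE('v)" and h: "metric_form h"
    and bil1: "\<And>p' p. bilinear (\<lambda>q' q. M p' p q' q)" and bil2: "\<And>q' q. bilinear (\<lambda>p' p. M p' p q' q)"
  shows "contract h (\<lambda>p p'. contract h (\<lambda>q q'. M p' p q' q)) =
    contract h (\<lambda>p' p. contract h (\<lambda>q' q. M p' p q' q))"
proof -
  have "bilinear (\<lambda>p' p. contract h (\<lambda>q' q. M p' p q' q))"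
    by (rule bilinear_contract) (rule bil2)
  from contract_flip[OF fd h this] show ?thesis
    by (simp only: contract_flip[OF fd h bil1])
qed


subsection \<open>Multilinearity and antisymmetry\<close>

lemma tensors_linear:
  assumes "\<alpha> \<in> tensors k" "i \<in> {1..k}"
  shows "linear (\<lambda>x. \<alpha> (v(i := x)))"
  using assms unfolding tensors_def by blast

lemma tensors_linear2:
  assumes "\<alpha> \<in> tensors k" "r \<in> {1..k}" "s \<in> {1..k}" "r \<noteq> s"
  shows "linear (\<lambda>x. \<alpha> (v(r := x, s := y)))" "linear (\<lambda>y. \<alpha> (v(r := x, s := y)))"
  using tensors_linear[OF assms(1,2), of "v(s := y)"] tensors_linear[OF assms(1,3), of "v(r := x)"] assms(4)
  by (simp_all add: fun_upd_twist[of r s])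

lemma tensors_linear_args4:
  assumes X: "X \<in> tensors 4"
  shows "linear (\<lambda>x. X (args4 x b c d))" "linear (\<lambda>x. X (args4 a x c d))"
    "linear (\<lambda>x. X (args4 a b x d))" "linear (\<lambda>x. X (args4 a b c x))"
proof -
  \<comment> \<open>\<open>args4\<close> returns its last argument at every position other than 1,
    2, 3, so in the fourth equation the two families agree only on the slots that a tensor sees. The
    fifth equation frees the base point from \<open>x\<close>.\<close>
  have eq: "X (args4 x b c d) = X ((args4 x b c d)(1 := x))"
    "X (args4 a x c d) = X ((args4 a b c d)(2 := x))"
    "X (args4 a b x d) = X ((args4 a b c d)(3 := x))"
    "X (args4 a b c x) = X ((args4 a b c d)(4 := x))"
    "X ((args4 x b c d)(1 := x)) = X ((args4 a b c d)(1 := x))" for x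
    by (rule tensors_cong[OF X], force simp: args4_def)+
  show "linear (\<lambda>x. X (args4 x b c d))" "linear (\<lambda>x. X (args4 a x c d))"
    "linear (\<lambda>x. X (args4 a b x d))" "linear (\<lambda>x. X (args4 a b c x))"
    unfolding eq by (rule tensors_linear[OF X]; simp)+
qed

text \<open>Over two slots, antisymmetrization is half the difference between a form and its
  transpose; a form fixed by it therefore changes sign under the transposition.\<close>

lemma alternate_pair_swap:
  assumes alt: "alternate {i, j} Y = Y" and ij: "i \<noteq> j"
  shows "Y (v \<circ> Transposition.transpose i j) = - Y v"
proof -
  have set: "{\<sigma>. \<sigma> permutes {i, j}} = {id, Transposition.transpose i j}"
    by (auto simp: permutes_doubleton_iff)
  have ne: "id \<noteq> Transposition.transpose i j" using ij by (metis id_apply transpose_apply_first)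
  have "Y v = (Y v - Y (v \<circ> Transposition.transpose i j)) / 2"
    using fun_cong[OF alt, of v] ij ne
    by (simp add: alternate_def set perm_act_def sign_swap_id o_def)
  then show ?thesis by simp
qed

lemma MC_tensors: "X \<in> MC \<Longrightarrow> X \<in> tensors 4"
  by (simp add: MC_def)

text \<open>The sign changes from the pairs 1, 2 and 3, 4 cancel.\<close>

lemma MC_double_swap:
  assumes X: "X \<in> MC"
  shows "X (args4 b a d c) = X (args4 a b c d)"
proof -
  have "X (args4 b a d c) = X ((args4 a b c d \<circ> Transposition.transpose 3 4) \<circ> Transposition.transpose 1 2)"
    by (rule tensors_cong[OF MC_tensors[OF X]])
      (auto simp: args4_def Transposition.transpose_def)
  also have "\<dots> = X (args4 a b c d)"
    using X by (simp add: MC_def alternate_pair_swap)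
  finally show ?thesis .
qed


subsection \<open>The summands of the operator\<close>

definition hat_term ::
  "('v::real_vector \<Rightarrow> 'v \<Rightarrow> real) \<Rightarrow> 'v form \<Rightarrow> 'v form \<Rightarrow> nat \<times> nat \<Rightarrow> 'v form" where
  "hat_term h X \<alpha> = (\<lambda>(r, s) v. contract h (\<lambda>p' p. contract h (\<lambda>q' q.
     X (args4 p' (v r) (v s) q') * \<alpha> (v(r := p, s := q)))))"

definition slot_pairs :: "nat \<Rightarrow> (nat \<times> nat) set" where
  "slot_pairs k = {(r, s). r \<in> {1..k} \<and> s \<in> {1..k} \<and> r \<noteq> s}"

lemma hat_eq_sum: "hat h k X \<alpha> v = 1 / real k * (\<Sum>rs\<in>slot_pairs k. hat_term h X \<alpha> rs v)"
  by (simp add: hat_def hat_term_def slot_pairs_def case_prod_unfold)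

section \<open>Linearity in the tensor and in \<open>X\<close>\<close>

lemma hat_term_linear_right:
  "hat_term h X (\<lambda>v. a * \<alpha> v + b * \<beta> v) rs v = a * hat_term h X \<alpha> rs v + b * hat_term h X \<beta> rs v"
  by (simp add: hat_term_def contract_def case_prod_unfold sum.distrib sum_distrib_left algebra_simps)

lemma hat_term_linear_left:
  "hat_term h (\<lambda>v. a * X v + b * Y v) \<alpha> rs v = a * hat_term h X \<alpha> rs v + b * hat_term h Y \<alpha> rs v"
  by (simp add: hat_term_def contract_def case_prod_unfold sum.distrib sum_distrib_left algebra_simps)

lemma hat_linear_right:
  "hat h k X (\<lambda>v. a * \<alpha> v + b * \<beta> v) = (\<lambda>v. a * hat h k X \<alpha> v + b * hat h k X \<beta> v)"
  by (rule ext) (simp add: hat_eq_sum hat_term_linear_right sum.distrib add_divide_distrib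
      flip: sum_distrib_left)

lemma hat_linear_left:
  "hat h k (\<lambda>v. a * X v + b * Y v) \<alpha> = (\<lambda>v. a * hat h k X \<alpha> v + b * hat h k Y \<alpha> v)"
  by (rule ext) (simp add: hat_eq_sum hat_term_linear_left sum.distrib add_divide_distrib
      flip: sum_distrib_left)

lemma hat_zero: "hat h k X (\<lambda>v. 0) = (\<lambda>v. 0)"
  using hat_linear_right[of h k X 0 "\<lambda>v. 0" 0 "\<lambda>v. 0"] by simp

text \<open>Needed for alternations, which are signed sums over permutations.\<close>

lemma hat_sum:
  "hat h k X (\<lambda>v. \<Sum>i\<in>A. c i * f i v) = (\<lambda>v. \<Sum>i\<in>A. c i * hat h k X (f i) v)"
proof (induction A rule: infinite_finite_induct)
  case (insert i A)
  then show ?case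
    using hat_linear_right[of h k X "c i" "f i" 1 "\<lambda>v. \<Sum>i\<in>A. c i * f i v"] by simp
\<comment> \<open>Over an empty or infinite index set both sums are 0 by convention.\<close>
qed (simp_all add: hat_zero)

section \<open>The operator maps tensors to tensors\<close>

lemma linear_contract:
  assumes "\<And>p q. linear (\<lambda>x. G x p q)"
  shows "linear (\<lambda>x. contract h (G x) :: real)"
  unfolding contract_def by (rule linear_compose_sum) (use assms in blast)

text \<open>Arguments \<open>r\<close> and \<open>s\<close> enter only through the second and third
  indices of \<open>X\<close>, since those slots of \<alpha> hold summation vectors; every other
  argument enters only through \<alpha>. Each summand is thus linear in every slot.\<close>

lemma hat_term_tensors:
  assumes X: "X \<in> tensors 4" and \<alpha>: "\<alpha> \<in> tensors k" and rs: "rs \<in> slot_pairs k"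
  shows "hat_term h X \<alpha> rs \<in> tensors k"
proof -
  obtain r s where rs_eq: "rs = (r, s)" and r: "r \<in> {1..k}" and s: "s \<in> {1..k}" and ne: "r \<noteq> s"
    using rs by (auto simp: slot_pairs_def)
  show ?thesis
    unfolding tensors_def mem_Collect_eq rs_eq hat_term_def prod.case
  proof (intro conjI allI impI ballI)
    fix v w :: "nat \<Rightarrow> 'a" assume vw: "\<forall>i\<in>{1..k}. v i = w i"
    have "\<alpha> (v(r := p, s := q)) = \<alpha> (w(r := p, s := q))" for p q
      by (rule tensors_cong[OF \<alpha>]) (use vw in simp)
    then show "contract h (\<lambda>p' p. contract h (\<lambda>q' q.
         X (args4 p' (v r) (v s) q') * \<alpha> (v(r := p, s := q)))) =
       contract h (\<lambda>p' p. contract h (\<lambda>q' q.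
         X (args4 p' (w r) (w s) q') * \<alpha> (w(r := p, s := q))))"
      using vw r s by simp
  next
    fix v :: "nat \<Rightarrow> 'a" and i assume i: "i \<in> {1..k}"
    have scale: "linear (\<lambda>x. f x * c)" "linear (\<lambda>x. c * f x)"
      if "linear f" for f :: "'a \<Rightarrow> real" and c
      using that by (simp_all add: linear_iff algebra_simps)
    have "linear (\<lambda>x. X (args4 p' ((v(i := x)) r) ((v(i := x)) s) q') * \<alpha> ((v(i := x))(r := p, s := q)))"
      for p' p q' q
    proof -
      consider "i = r" | "i = s" | "i \<noteq> r" "i \<noteq> s" by blast
      then show ?thesis
      proof cases
        case 1
        then show ?thesis using ne by (simp add: scale tensors_linear_args4[OF X])
      next
        case 2
        then have "(v(i := x))(r := p, s := q) = v(r := p, s := q)" for x by auto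
        then show ?thesis using ne 2 by (simp add: scale tensors_linear_args4[OF X])
      next
        case 3
        then have "(v(i := x))(r := p, s := q) = (v(r := p, s := q))(i := x)" for x by auto
        then show ?thesis using 3 tensors_linear[OF \<alpha> i, of "v(r := p, s := q)"] by (simp add: scale)
      qed
    qed
    then show "linear (\<lambda>x. contract h (\<lambda>p' p. contract h (\<lambda>q' q.
         X (args4 p' ((v(i := x)) r) ((v(i := x)) s) q') * \<alpha> ((v(i := x))(r := p, s := q)))))"
      by (intro linear_contract)
  qed
qed

lemma hat_tensors:
  assumes X: "X \<in> tensors 4" and \<alpha>: "\<alpha> \<in> tensors k"
  shows "hat h k X \<alpha> \<in> tensors k"
  unfolding tensors_def mem_Collect_eq
proof (intro conjI allI impI ballI)
  fix v w :: "nat \<Rightarrow> 'a" assume "\<forall>i\<in>{1..k}. v i = w i"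
  then have "hat_term h X \<alpha> rs v = hat_term h X \<alpha> rs w" if "rs \<in> slot_pairs k" for rs
    using tensors_cong[OF hat_term_tensors[OF X \<alpha> that]] by blast
  then show "hat h k X \<alpha> v = hat h k X \<alpha> w" by (simp add: hat_eq_sum)
next
  fix v :: "nat \<Rightarrow> 'a" and i assume "i \<in> {1..k}"
  then have "linear (\<lambda>x. \<Sum>rs\<in>slot_pairs k. hat_term h X \<alpha> rs (v(i := x)))"
    by (intro linear_compose_sum ballI tensors_linear[OF hat_term_tensors[OF X \<alpha>]])
  then show "linear (\<lambda>x. hat h k X \<alpha> (v(i := x)))"
    unfolding hat_eq_sum by (simp add: linear_iff add_divide_distrib)
qed


subsection \<open>Equivariance\<close>

lemma hat_term_perm_act:
  assumes \<sigma>: "bij \<sigma>"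
  shows "hat_term h X (perm_act \<sigma> \<alpha>) (r, s) v = hat_term h X \<alpha> (\<sigma> r, \<sigma> s) (\<lambda>j. v (inv \<sigma> j))"
proof -
  have inv: "inv \<sigma> (\<sigma> i) = i" "\<sigma> (inv \<sigma> i) = i" for i
    using \<sigma> by (simp_all add: bij_is_inj bij_is_surj surj_f_inv_f)
  \<comment> \<open>Index \<open>r\<close> of the permuted tensor is carried by slot
    \<open>\<sigma> r\<close> of \<alpha>, so a vector put into argument \<open>r\<close> arrives
    there. Correspondingly, \<open>v r\<close> is entry \<open>\<sigma> r\<close> of the permuted
    family, so \<open>X\<close> sees the same vectors on both sides.\<close>
  have "(\<lambda>j. (v(r := p, s := q)) (inv \<sigma> j)) = (\<lambda>j. v (inv \<sigma> j))(\<sigma> r := p, \<sigma> s := q)" for p q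
    using inv by (auto simp: fun_eq_iff)
  then show ?thesis by (simp add: hat_term_def perm_act_def inv)
qed

lemma hat_perm_act:
  assumes \<sigma>: "\<sigma> permutes {1..k}"
  shows "hat h k X (perm_act \<sigma> \<alpha>) = perm_act \<sigma> (hat h k X \<alpha>)"
proof
  fix v
  have "(\<Sum>rs\<in>slot_pairs k. hat_term h X (perm_act \<sigma> \<alpha>) rs v)
      = (\<Sum>rs\<in>slot_pairs k. hat_term h X \<alpha> rs (\<lambda>j. v (inv \<sigma> j)))"
  proof (rule sum.reindex_bij_witness[where i = "map_prod (inv \<sigma>) (inv \<sigma>)" and j = "map_prod \<sigma> \<sigma>"])
    fix rs assume "rs \<in> slot_pairs k"
    then show "map_prod (inv \<sigma>) (inv \<sigma>) (map_prod \<sigma> \<sigma> rs) = rs"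
      "map_prod \<sigma> \<sigma> (map_prod (inv \<sigma>) (inv \<sigma>) rs) = rs"
      by (cases rs; simp add: permutes_inverses[OF \<sigma>])+
    \<comment> \<open>Stated for a general permutation so that it applies both to
      \<open>\<sigma>\<close> and to its inverse; injectivity keeps the two slots distinct.\<close>
    have "map_prod \<tau> \<tau> rs \<in> slot_pairs k" if "\<tau> permutes {1..k}" for \<tau>
      using \<open>rs \<in> slot_pairs k\<close> permutes_in_image[OF that] inj_eq[OF permutes_inj[OF that]]
      unfolding slot_pairs_def by (cases rs) (simp del: atLeastAtMost_iff)
    from this[OF \<sigma>] this[OF permutes_inv[OF \<sigma>]]
    show "map_prod \<sigma> \<sigma> rs \<in> slot_pairs k" "map_prod (inv \<sigma>) (inv \<sigma>) rs \<in> slot_pairs k" .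
    show "hat_term h X \<alpha> (map_prod \<sigma> \<sigma> rs) (\<lambda>j. v (inv \<sigma> j)) = hat_term h X (perm_act \<sigma> \<alpha>) rs v"
      by (cases rs) (simp add: hat_term_perm_act[OF permutes_bij[OF \<sigma>]])
  qed
  then show "hat h k X (perm_act \<sigma> \<alpha>) v = perm_act \<sigma> (hat h k X \<alpha>) v"
    by (simp add: hat_eq_sum perm_act_def)
qed

lemma hat_alternate:
  assumes S: "S \<subseteq> {1..k}"
  shows "hat h k X (alternate S \<alpha>) = alternate S (hat h k X \<alpha>)"
proof -
  \<comment> \<open>Absorbing the normalization into the coefficients gives the shape of
    \<open>hat_sum\<close>. Each term then commutes because a permutation of \<open>S\<close> also
    permutes all \<open>k\<close> slots.\<close>
  have alt: "alternate S \<beta> = (\<lambda>v. \<Sum>\<sigma> | \<sigma> permutes S. (of_int (sign \<sigma>) / fact (card S)) * perm_act \<sigma> \<beta> v)"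
    for \<beta> :: "'a form"
    by (simp add: alternate_def sum_divide_distrib)
  show ?thesis
    unfolding alt hat_sum
    by (intro ext sum.cong refl) (simp add: hat_perm_act[OF permutes_subset[OF _ S]])
qed

text \<open>The defining conditions say that certain alternations fix or annihilate the tensor. Both
  survive an operator that commutes with these alternations and sends 0 to 0.\<close>

lemma hat_young_subspace:
  assumes X: "X \<in> tensors 4" and cs: "young_filling k cs" and \<alpha>: "\<alpha> \<in> young_subspace k cs"
  shows "hat h k X \<alpha> \<in> young_subspace k cs"
proof -
  have sub: "set c \<subseteq> {1..k}" if "c \<in> set cs" for c
    using cs that unfolding young_filling_def by auto
  have "alternate (set c) (hat h k X \<alpha>) = hat h k X \<alpha>" if "c \<in> set cs" for c
    using \<alpha> that by (simp add: young_subspace_def flip: hat_alternate[OF sub])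
  moreover have "alternate (insert j (set (cs ! a))) (hat h k X \<alpha>) = (\<lambda>v. 0)"
    if "a < b" "b < length cs" "j \<in> set (cs ! b)" for a b j
  proof -
    have "insert j (set (cs ! a)) \<subseteq> {1..k}"
      using that sub[of "cs ! a"] sub[of "cs ! b"] by auto
    moreover have "alternate (insert j (set (cs ! a))) \<alpha> = (\<lambda>v. 0)"
      using \<alpha> that by (simp add: young_subspace_def)
    ultimately show ?thesis by (simp add: hat_zero flip: hat_alternate)
  qed
  ultimately show ?thesis
    using \<alpha> hat_tensors[OF X] unfolding young_subspace_def by blast
qed

section \<open>Equivariance under the orthogonal group\<close>

lemma bilinear_hat_inner:
  fixes X \<alpha> :: "'v::real_vector form"
  assumes "X \<in> tensors 4" "\<alpha> \<in> tensors k" "(r, s) \<in> slot_pairs k"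
  shows "bilinear (\<lambda>q' q. X (args4 p' y z q') * \<alpha> (v(r := p, s := q)))"
    and "bilinear (\<lambda>p' p. X (args4 p' y z q') * \<alpha> (v(r := p, s := q)))"
proof -
  have "r \<in> {1..k}" "s \<in> {1..k}" "r \<noteq> s" using assms(3) by (auto simp: slot_pairs_def)
  \<comment> \<open>In each contracted pair the primed vector enters only \<open>X\<close> and the
    other only \<alpha>, so the integrand is a product of two linear functions.\<close>
  note lin = bilinear_times tensors_linear_args4[OF assms(1)] tensors_linear2[OF assms(2) this]
  show "bilinear (\<lambda>q' q. X (args4 p' y z q') * \<alpha> (v(r := p, s := q)))" by (intro lin)
  show "bilinear (\<lambda>p' p. X (args4 p' y z q') * \<alpha> (v(r := p, s := q)))" by (intro lin)
qed

lemma hat_term_lin_act: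
  fixes h :: "'v::real_vector \<Rightarrow> 'v \<Rightarrow> real"
  assumes fd: "finite_dim TYPE('v)" and h: "metric_form h" and g: "g \<in> orthogonal_group h"
    and X: "X \<in> tensors 4" and \<alpha>: "\<alpha> \<in> tensors k" and rs: "rs \<in> slot_pairs k"
  shows "hat_term h (lin_act g X) \<alpha> rs v = hat_term h X (lin_act (inv g) \<alpha>) rs (\<lambda>j. inv g (v j))"
proof -
  obtain r s where rs_eq: "rs = (r, s)" by force
  have bij: "bij g" using g by (simp add: orthogonal_group_def)
  then have gi: "g (inv g x) = x" "inv (inv g) = g" for x
    by (simp_all add: bij_is_surj surj_f_inv_f inv_inv_eq)
  \<comment> \<open>Apply the isometry \<open>g\<close> to both arguments on the left.\<close>
  have adj: "h (inv g x) y = h x (g y)" for x y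
    using g gi(1)[of x] unfolding orthogonal_group_def by (metis (mono_tags, lifting) mem_Collect_eq)
  note bil = bilinear_hat_inner[OF X \<alpha> rs[unfolded rs_eq]]
  have args: "(\<lambda>j. inv g (args4 a b c d j)) = args4 (inv g a) (inv g b) (inv g c) (inv g d)" for a b c d
    by (auto simp: args4_def)
  \<comment> \<open>The action of \<open>inv g\<close> on \<alpha> applies \<open>g\<close> to all
    arguments: it cancels \<open>inv g\<close> everywhere except at the two inserted
    vectors.\<close>
  have upd: "(\<lambda>j. g (((\<lambda>j. inv g (v j))(r := p, s := q)) j)) = v(r := g p, s := g q)" for p q
    by (auto simp: gi)
  let ?M = "\<lambda>p' p q' q. X (args4 p' (inv g (v r)) (inv g (v s)) q') * \<alpha> (v(r := p, s := q))"
  have "hat_term h (lin_act g X) \<alpha> rs v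
      = contract h (\<lambda>p' p. contract h (\<lambda>q' q. ?M (inv g p') p (inv g q') q))"
    by (simp add: hat_term_def rs_eq lin_act_def args)
  also have "\<dots> = contract h (\<lambda>p' p. contract h (\<lambda>q' q. ?M p' (g p) q' (g q)))"
    by (rule contract2_adjoint[OF fd h, where M = ?M]) (rule bil adj)+
  also have "\<dots> = hat_term h X (lin_act (inv g) \<alpha>) rs (\<lambda>j. inv g (v j))"
    by (simp add: hat_term_def rs_eq lin_act_def gi(2) upd del: fun_upd_apply)
  finally show ?thesis .
qed

lemma hat_lin_act:
  fixes h :: "'v::real_vector \<Rightarrow> 'v \<Rightarrow> real"
  assumes "finite_dim TYPE('v)" "metric_form h" "g \<in> orthogonal_group h"
    and "X \<in> tensors 4" "\<alpha> \<in> tensors k"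
  shows "hat h k (lin_act g X) \<alpha> = lin_act g (hat h k X (lin_act (inv g) \<alpha>))"
proof
  fix v
  show "hat h k (lin_act g X) \<alpha> v = lin_act g (hat h k X (lin_act (inv g) \<alpha>)) v"
    by (simp add: hat_eq_sum hat_term_lin_act[OF assms] lin_act_def[of g "hat h k X _"])
qed


subsection \<open>Self-adjointness\<close>

text \<open>Here the dual basis vectors go into \<alpha> and the basis vectors into
  \<open>X\<close>. This form suits the second factor of a pairing, which is evaluated on dual
  vectors.\<close>

lemma hat_term_flip:
  fixes h :: "'v::real_vector \<Rightarrow> 'v \<Rightarrow> real"
  assumes fd: "finite_dim TYPE('v)" and h: "metric_form h"
    and X: "X \<in> tensors 4" and \<alpha>: "\<alpha> \<in> tensors k" and rs: "(r, s) \<in> slot_pairs k"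
  shows "hat_term h X \<alpha> (r, s) v = contract h (\<lambda>p p'. contract h (\<lambda>q q'.
     X (args4 p' (v r) (v s) q') * \<alpha> (v(r := p, s := q))))"
proof -
  let ?M = "\<lambda>p' p q' q. X (args4 p' (v r) (v s) q') * \<alpha> (v(r := p, s := q))"
  have "contract h (\<lambda>p p'. contract h (\<lambda>q q'. ?M p' p q' q)) =
      contract h (\<lambda>p' p. contract h (\<lambda>q' q. ?M p' p q' q))"
    by (rule contract2_flip[OF fd h, where M = ?M]) (rule bilinear_hat_inner[OF X \<alpha> rs])+
  then show ?thesis by (simp only: hat_term_def prod.case)
qed

text \<open>Written out, both sides are sums over an index family \<open>I\<close> and two extra
  indices \<open>b\<close>, \<open>c\<close>. Exchanging \<open>b\<close>, \<open>c\<close> with the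
  entries of \<open>I\<close> at \<open>r\<close>, \<open>s\<close> matches the terms, up to a swap
  in each antisymmetric pair of \<open>X\<close>.\<close>

lemma pairing_hat_term:
  fixes h :: "'v::real_vector \<Rightarrow> 'v \<Rightarrow> real"
  assumes fd: "finite_dim TYPE('v)" and h: "metric_form h" and X: "X \<in> MC"
    and \<beta>: "\<beta> \<in> tensors k" and rs: "rs \<in> slot_pairs k"
  shows "pairing h k (hat_term h X \<alpha> rs) \<beta> = pairing h k \<alpha> (hat_term h X \<beta> rs)"
proof -
  obtain r s where rs_eq: "rs = (r, s)" and r: "r \<in> {1..k}" and s: "s \<in> {1..k}" and ne: "r \<noteq> s"
    using rs by (auto simp: slot_pairs_def)
  let ?B = "some_basis :: 'v set" and ?e = "dual_vec h (some_basis :: 'v set)"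
  let ?P = "({1..k} \<rightarrow>\<^sub>E ?B) \<times> ?B \<times> ?B"
  let ?swap = "\<lambda>(I, b, c). (I(r := b, s := c), I r, I s)"
  have upd: "(\<lambda>i. ?e (I i))(r := ?e b, s := ?e c) = (\<lambda>i. ?e ((I(r := b, s := c)) i))" for I b c
    by auto
  have "pairing h k (hat_term h X \<alpha> rs) \<beta> = (\<Sum>(I, b, c)\<in>?P.
      X (args4 (?e b) (I r) (I s) (?e c)) * \<alpha> (I(r := b, s := c)) * \<beta> (\<lambda>i. ?e (I i)))"
    by (simp add: pairing_def rs_eq hat_term_def contract_def sum_distrib_right
        sum.cartesian_product case_prod_unfold)
  also have "\<dots> = (\<Sum>(I, b, c)\<in>?P.
      X (args4 b (?e (I r)) (?e (I s)) c) * \<alpha> I * \<beta> (\<lambda>i. ?e ((I(r := b, s := c)) i)))"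
  proof (rule sum.reindex_bij_witness[where i = ?swap and j = ?swap])
    fix x assume x: "x \<in> ?P"
    obtain I b c where x_eq: "x = (I, b, c)" by (metis prod.exhaust)
    \<comment> \<open>Since \<open>r\<close> and \<open>s\<close> differ, the exchange is an
      involution and serves as its own inverse in the reindexing.\<close>
    have restore: "I(r := b, s := c, r := I r, s := I s) = I" "(I(r := b, s := c)) r = b"
      using ne by auto
    show "?swap (?swap x) = x" "?swap (?swap x) = x"
      unfolding x_eq prod.case restore by simp_all
    show "?swap x \<in> ?P" "?swap x \<in> ?P"
      using x r s unfolding x_eq by (auto simp: PiE_iff extensional_def)
    show "(case ?swap x of (I, b, c) \<Rightarrow>
        X (args4 b (?e (I r)) (?e (I s)) c) * \<alpha> I * \<beta> (\<lambda>i. ?e ((I(r := b, s := c)) i)))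
      = (case x of (I, b, c) \<Rightarrow>
        X (args4 (?e b) (I r) (I s) (?e c)) * \<alpha> (I(r := b, s := c)) * \<beta> (\<lambda>i. ?e (I i)))"
      unfolding x_eq prod.case restore by (simp add: MC_double_swap[OF X])
  qed
  also have "\<dots> = pairing h k \<alpha> (hat_term h X \<beta> rs)"
    \<comment> \<open>After the flip \<beta> receives only dual vectors, so by \<open>upd\<close>
      its arguments are the dual family of one modified index family.\<close>
    unfolding pairing_def rs_eq hat_term_flip[OF fd h MC_tensors[OF X] \<beta> rs[unfolded rs_eq]]
      contract_def upd
    by (simp add: sum_distrib_left sum.cartesian_product case_prod_unfold mult_ac del: fun_upd_apply)
  finally show ?thesis .
qed

lemma pairing_hat:
  fixes h :: "'v::real_vector \<Rightarrow> 'v \<Rightarrow> real"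
  assumes "finite_dim TYPE('v)" "metric_form h" "X \<in> MC" "\<beta> \<in> tensors k"
  shows "pairing h k (hat h k X \<alpha>) \<beta> = pairing h k \<alpha> (hat h k X \<beta>)"
proof -
  have "pairing h k (hat h k X \<alpha>) \<beta>
      = 1 / real k * (\<Sum>rs\<in>slot_pairs k. pairing h k (hat_term h X \<alpha> rs) \<beta>)"
    unfolding pairing_def hat_eq_sum
    by (subst sum.swap) (simp add: sum_distrib_left sum_distrib_right mult_ac)
  also have "\<dots> = 1 / real k * (\<Sum>rs\<in>slot_pairs k. pairing h k \<alpha> (hat_term h X \<beta> rs))"
    by (simp add: pairing_hat_term[OF assms])
  also have "\<dots> = pairing h k \<alpha> (hat h k X \<beta>)"
    unfolding pairing_def hat_eq_sum
    by (subst sum.swap) (simp add: sum_distrib_left mult_ac)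
  finally show ?thesis .
qed

theorem lemma4p2:
  fixes h :: "'v::real_vector \<Rightarrow> 'v \<Rightarrow> real" and k :: nat
  assumes fd: "finite_dim TYPE('v)" and h: "metric_form h" and k: "k \<ge> 2"
  shows
    "(\<forall>X\<in>MC. \<forall>\<alpha>\<in>tensors k. hat h k X \<alpha> \<in> tensors k) \<and>
     (\<forall>X\<in>MC. \<forall>\<alpha>\<in>tensors k. \<forall>\<beta>\<in>tensors k. \<forall>a b.
        hat h k X (\<lambda>v. a * \<alpha> v + b * \<beta> v) = (\<lambda>v. a * hat h k X \<alpha> v + b * hat h k X \<beta> v)) \<and>
     (\<forall>X\<in>MC. \<forall>Y\<in>MC. \<forall>a b. \<forall>\<alpha>\<in>tensors k.
        hat h k (\<lambda>v. a * X v + b * Y v) \<alpha> = (\<lambda>v. a * hat h k X \<alpha> v + b * hat h k Y \<alpha> v)) \<and>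
     (\<forall>X\<in>MC. \<forall>\<sigma>. \<sigma> permutes {1..k} \<longrightarrow> (\<forall>\<alpha>\<in>tensors k.
        hat h k X (perm_act \<sigma> \<alpha>) = perm_act \<sigma> (hat h k X \<alpha>))) \<and>
     (\<forall>X\<in>MC. \<forall>cs. young_filling k cs \<longrightarrow> hat h k X ` young_subspace k cs \<subseteq> young_subspace k cs) \<and>
     (\<forall>X\<in>MC. \<forall>g\<in>orthogonal_group h. \<forall>\<alpha>\<in>tensors k.
        hat h k (lin_act g X) \<alpha> = lin_act g (hat h k X (lin_act (inv g) \<alpha>))) \<and>
     (\<forall>X\<in>MC. \<forall>\<alpha>\<in>tensors k. \<forall>\<beta>\<in>tensors k.
        pairing h k (hat h k X \<alpha>) \<beta> = pairing h k \<alpha> (hat h k X \<beta>))"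
proof (intro conjI)
  show "\<forall>X\<in>MC. \<forall>\<alpha>\<in>tensors k. hat h k X \<alpha> \<in> tensors k"
    by (intro ballI hat_tensors[OF MC_tensors])
  show "\<forall>X\<in>MC. \<forall>\<alpha>\<in>tensors k. \<forall>\<beta>\<in>tensors k. \<forall>a b.
      hat h k X (\<lambda>v. a * \<alpha> v + b * \<beta> v) = (\<lambda>v. a * hat h k X \<alpha> v + b * hat h k X \<beta> v)"
    by (intro ballI allI hat_linear_right)
  show "\<forall>X\<in>MC. \<forall>Y\<in>MC. \<forall>a b. \<forall>\<alpha>\<in>tensors k.
      hat h k (\<lambda>v. a * X v + b * Y v) \<alpha> = (\<lambda>v. a * hat h k X \<alpha> v + b * hat h k Y \<alpha> v)"
    by (intro ballI allI hat_linear_left)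
  show "\<forall>X\<in>MC. \<forall>\<sigma>. \<sigma> permutes {1..k} \<longrightarrow> (\<forall>\<alpha>\<in>tensors k.
      hat h k X (perm_act \<sigma> \<alpha>) = perm_act \<sigma> (hat h k X \<alpha>))"
    by (intro ballI allI impI hat_perm_act)
  show "\<forall>X\<in>MC. \<forall>cs. young_filling k cs \<longrightarrow> hat h k X ` young_subspace k cs \<subseteq> young_subspace k cs"
    using hat_young_subspace[OF MC_tensors] by blast
  show "\<forall>X\<in>MC. \<forall>g\<in>orthogonal_group h. \<forall>\<alpha>\<in>tensors k.
      hat h k (lin_act g X) \<alpha> = lin_act g (hat h k X (lin_act (inv g) \<alpha>))"
    using hat_lin_act[OF fd h _ MC_tensors] by blast
  show "\<forall>X\<in>MC. \<forall>\<alpha>\<in>tensors k. \<forall>\<beta>\<in>tensors k.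
      pairing h k (hat h k X \<alpha>) \<beta> = pairing h k \<alpha> (hat h k X \<beta>)"
    by (intro ballI pairing_hat[OF fd h])
qed

end
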